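(* Let $n\ge 1$. The mapping $\theta:\mathrm{Bur}^{01}[n]\to\Omega[n]$ defined by $\theta(u,v)=\bigl((u^{rc})^{\star},v^r\bigr)$ is a bijection.
   Context: Let $[n]=\{1,\dots,n\}$. A Cayley permutation on $[n]$ is a map $v:[n]\to[n]$ with image $[k]$ for some $k\le n$. $\mathrm{Cay}[n]$ is the set of Cayley permutations on $[n]$ and $\mathrm{I}[n]$ its subset of weakly increasing ones. For $v\in\mathrm{Cay}[n]$: $D(v)=\{i\in[n-1]: v(i)\ge v(i+1)\}$ and $D^{\circ}(v)=\{i\in[n-1]: v(i)>v(i+1)\}$. $\mathrm{Bur}^{01}[n]=\{(u,v)\in\mathrm{I}[n]\times\mathrm{Cay}[n]: D(u)\subseteq D^{\circ}(v)\}$ and $\Omega[n]=\{(u,v)\in\mathrm{I}[n]\times\mathrm{Cay}[n]: D(u)\supseteq D(v)\}$. The reverse of $v$ is $v^r(i)=v(n+1-i)$; the complement of $v$ is $v^c(i)=\max(v)+1-v(i)$, where $\max(v)$ is the largest value of $v$; $u^{rc}=(u^r)^c$. For $u\in\mathrm{I}[n]$, the conjugate $u^{\star}$ is the unique element of $\mathrm{I}[n]$ with $D(u^{\star})=[n-1]\setminus D(u)$ (an element of $\mathrm{I}[n]$ is determined by its weak descent set, and every subset of $[n-1]$ occurs). *)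

theory Defs
  imports Main "HOL-Library.FuncSet"
begin

text \<open>
  A map on \<open>[n]\<close> is a function on \<open>nat\<close> that is extensional on \<open>{1..n}\<close> (with value
  \<open>undefined\<close> elsewhere), so that equality of functions is equality of maps on \<open>[n]\<close>.
\<close>

definition Cay :: "nat \<Rightarrow> (nat \<Rightarrow> nat) set" where
  "Cay n = {v \<in> {1..n} \<rightarrow>\<^sub>E {1..n}. \<exists>k\<le>n. v ` {1..n} = {1..k}}"

definition inc_Cay :: "nat \<Rightarrow> (nat \<Rightarrow> nat) set" where
  "inc_Cay n = {v \<in> Cay n. mono_on {1..n} v}"

definition weak_descents :: "nat \<Rightarrow> (nat \<Rightarrow> nat) \<Rightarrow> nat set" where
  "weak_descents n v = {i \<in> {1..n - 1}. v i \<ge> v (i + 1)}"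

definition strict_descents :: "nat \<Rightarrow> (nat \<Rightarrow> nat) \<Rightarrow> nat set" where
  "strict_descents n v = {i \<in> {1..n - 1}. v i > v (i + 1)}"

definition Bur01 :: "nat \<Rightarrow> ((nat \<Rightarrow> nat) \<times> (nat \<Rightarrow> nat)) set" where
  "Bur01 n = {(u, v) \<in> inc_Cay n \<times> Cay n. weak_descents n u \<subseteq> strict_descents n v}"

definition Omega :: "nat \<Rightarrow> ((nat \<Rightarrow> nat) \<times> (nat \<Rightarrow> nat)) set" where
  "Omega n = {(u, v) \<in> inc_Cay n \<times> Cay n. weak_descents n u \<supseteq> weak_descents n v}"

definition reverse_on :: "nat \<Rightarrow> (nat \<Rightarrow> nat) \<Rightarrow> nat \<Rightarrow> nat" where
  "reverse_on n v = (\<lambda>i\<in>{1..n}. v (n + 1 - i))"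

definition complement_on :: "nat \<Rightarrow> (nat \<Rightarrow> nat) \<Rightarrow> nat \<Rightarrow> nat" where
  "complement_on n v = (\<lambda>i\<in>{1..n}. Max (v ` {1..n}) + 1 - v i)"

definition conjugate :: "nat \<Rightarrow> (nat \<Rightarrow> nat) \<Rightarrow> nat \<Rightarrow> nat" where
  "conjugate n u = (THE w. w \<in> inc_Cay n \<and> weak_descents n w = {1..n - 1} - weak_descents n u)"

definition theta :: "nat \<Rightarrow> (nat \<Rightarrow> nat) \<times> (nat \<Rightarrow> nat) \<Rightarrow> (nat \<Rightarrow> nat) \<times> (nat \<Rightarrow> nat)" where
  "theta n = (\<lambda>(u, v). (conjugate n (complement_on n (reverse_on n u)), reverse_on n v))"

end

theory Submission
  imports Defs
begin

text \<open>
  Both components of \<open>theta\<close> are involutions, so \<open>theta\<close> is an involution of the full product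
  \<open>inc_Cay n \<times> Cay n\<close>, and it only remains to see that it exchanges the two subsets
  \<open>Bur01 n\<close> and \<open>Omega n\<close>.

  On descent sets (weak ones for \<open>u\<close>, strict ones for \<open>v\<close>) both components act
  by the same order-reversing operation \<open>S \<mapsto> co_mirror n S\<close>:
  reflect \<open>S\<close> in the midpoint of \<open>{1..n-1}\<close> and take the complement. Reversing \<open>v\<close> reads each
  comparison of neighbours backwards, so the weak descents of the reverse are the mirror images of
  the positions where \<open>v\<close> does not strictly descend (\<open>weak_descents_reverse_on\<close>). For \<open>u\<close>, reversal
  and complement together only mirror the descent set, and the conjugate complements it
  (\<open>weak_descents_rev_conjugate\<close>). Since \<open>co_mirror n\<close> reverses inclusions, the condition
  \<open>D(u) \<subseteq> D\<^sup>\<circ>(v)\<close> becomes the condition \<open>D(v) \<subseteq> D(u)\<close> on the images.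

  The first component is an involution because \<open>co_mirror n\<close> is one and because an increasing Cayley
  permutation is determined by its weak descent set: it starts at \<open>1\<close>, stays constant at its weak
  descents and goes up by exactly one elsewhere (\<open>inc_Cay_1\<close>, \<open>inc_Cay_step\<close>).
\<close>

section \<open>Increasing Cayley permutations and their descent sets\<close>

lemma inc_Cay_1:
  assumes "u \<in> inc_Cay n" "n \<ge> 1"
  shows "u 1 = 1"
proof -
  obtain k where k: "u ` {1..n} = {1..k}" and mono: "mono_on {1..n} u"
    using assms(1) by (auto simp: inc_Cay_def Cay_def)
  have u1: "u 1 \<in> {1..k}"
    using k assms(2) by (metis atLeastAtMost_iff image_eqI order_refl)
  then have "1 \<in> u ` {1..n}" using k by auto
  then obtain j where "j \<in> {1..n}" "u j = 1" by auto
  then have "u 1 \<le> 1" using mono_onD[OF mono, of 1 j] by auto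
  then show ?thesis using u1 by simp
qed

text \<open>A jump by two or more would skip a value: by monotonicity that value could occur at no other
  position either, so the image would have a gap.\<close>

lemma inc_Cay_step:
  assumes "u \<in> inc_Cay n" "i \<in> {1..n - 1}"
  shows "u (Suc i) = (if i \<in> weak_descents n u then u i else Suc (u i))"
proof -
  obtain k where k: "u ` {1..n} = {1..k}" and mono: "mono_on {1..n} u"
    using assms(1) by (auto simp: inc_Cay_def Cay_def)
  have i: "i \<in> {1..n}" "Suc i \<in> {1..n}" using assms(2) by auto
  have le: "u i \<le> u (Suc i)" using mono_onD[OF mono i] by simp
  have "\<not> Suc (u i) < u (Suc i)"
  proof
    assume skip: "Suc (u i) < u (Suc i)"
    have "u (Suc i) \<in> {1..k}" using k i by blast
    then have "Suc (u i) \<in> u ` {1..n}" using k skip by auto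
    then obtain j where j: "j \<in> {1..n}" "u j = Suc (u i)" by auto
    show False
    proof (cases "j \<le> i")
      case True
      then show False using mono_onD[OF mono j(1) i(1)] j(2) by simp
    next
      case False
      then show False using mono_onD[OF mono i(2) j(1)] j(2) skip by simp
    qed
  qed
  then show ?thesis using le assms(2) by (auto simp: weak_descents_def)
qed

lemma inj_on_weak_descents: "inj_on (weak_descents n) (inc_Cay n)"
proof (rule inj_onI)
  fix u w
  assume u: "u \<in> inc_Cay n" and w: "w \<in> inc_Cay n"
    and D: "weak_descents n u = weak_descents n w"
  have "u i = w i" if "1 \<le> i" "i \<le> n" for i
    using that
  proof (induction i rule: dec_induct)
    case base
    then show ?case using inc_Cay_1[OF u] inc_Cay_1[OF w] by simp
  next
    case (step i)
    then have "i \<in> {1..n - 1}" by auto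
    then show ?case using inc_Cay_step[OF u] inc_Cay_step[OF w] step D by auto
  qed
  moreover have "u \<in> extensional {1..n}" "w \<in> extensional {1..n}"
    using u w by (auto simp: inc_Cay_def Cay_def PiE_def)
  ultimately show "u = w" by (intro extensionalityI[of u "{1..n}" w]) auto
qed

lemma image_unit_steps:
  fixes f :: "nat \<Rightarrow> nat"
  assumes "f 1 = 1" and "\<And>i. i \<ge> 1 \<Longrightarrow> f (Suc i) = f i \<or> f (Suc i) = Suc (f i)"
    and "m \<ge> 1"
  shows "f ` {1..m} = {1..f m}"
  using assms(3)
proof (induction m rule: dec_induct)
  case base
  then show ?case using assms(1) by simp
next
  case (step m)
  have "{1..Suc m} = insert (Suc m) {1..m}" by auto
  moreover have "f m \<in> {1..f m}" using step by auto
  ultimately show ?case using step assms(2)[of m] by (auto simp: insert_absorb)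
qed

text \<open>
  To realise \<open>S\<close> as a weak descent set, let the value at \<open>i\<close> be one more than the number
  of positions before \<open>i\<close> outside \<open>S\<close>.
\<close>

lemma ex_inc_Cay_weak_descents:
  assumes "S \<subseteq> {1..n - 1}" "n \<ge> 1"
  shows "\<exists>w \<in> inc_Cay n. weak_descents n w = S"
proof -
  define f where "f i = Suc (card ({1..<i} - S))" for i
  have step: "f (Suc i) = (if i \<in> S then f i else Suc (f i))" if "i \<ge> 1" for i
  proof -
    have "{1..<Suc i} = insert i {1..<i}" using that by auto
    then show ?thesis by (auto simp: f_def insert_Diff_if)
  qed
  have mono: "f i \<le> f j" if "i \<le> j" for i j
    unfolding f_def using that by (auto intro!: card_mono)
  have f_bound: "f n \<le> n"
    using card_mono[of "{1..<n}" "{1..<n} - S"] assms(2) by (simp add: f_def)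
  have img: "f ` {1..n} = {1..f n}"
    by (rule image_unit_steps) (use assms(2) step in \<open>auto simp: f_def\<close>)
  let ?w = "restrict f {1..n}"
  have img': "?w ` {1..n} = {1..f n}" using img by simp
  have "?w \<in> {1..n} \<rightarrow>\<^sub>E {1..n}"
    using img f_bound by fastforce
  then have "?w \<in> Cay n" using img' f_bound by (auto simp: Cay_def)
  moreover have "mono_on {1..n} ?w" using mono by (auto intro!: mono_onI)
  moreover have "weak_descents n ?w = S"
    using assms step by (auto simp: weak_descents_def split: if_splits)
  ultimately show ?thesis by (auto simp: inc_Cay_def)
qed

text \<open>
  The conjugate sees \<open>u\<close> only through its weak descent set. Computing with reverse complements
  therefore reduces to computing their descent sets.
\<close>

lemma conjugate:
  assumes "n \<ge> 1"
  shows "conjugate n u \<in> inc_Cay n"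
    and "weak_descents n (conjugate n u) = {1..n - 1} - weak_descents n u"
proof -
  have "\<exists>!w. w \<in> inc_Cay n \<and> weak_descents n w = {1..n - 1} - weak_descents n u"
    using ex_inc_Cay_weak_descents[of "{1..n - 1} - weak_descents n u" n] assms
      inj_onD[OF inj_on_weak_descents] by (metis Diff_subset)
  from theI'[OF this]
  show "conjugate n u \<in> inc_Cay n"
    and "weak_descents n (conjugate n u) = {1..n - 1} - weak_descents n u"
    by (auto simp: conjugate_def)
qed

section \<open>The action of the two components on descent sets\<close>

definition co_mirror :: "nat \<Rightarrow> nat set \<Rightarrow> nat set" where
  "co_mirror n S = {i \<in> {1..n - 1}. n - i \<notin> S}"

lemma co_mirror_co_mirror:
  assumes "S \<subseteq> {1..n - 1}"
  shows "co_mirror n (co_mirror n S) = S"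
  using assms by (fastforce simp: co_mirror_def)

lemma co_mirror_subset_iff:
  assumes "S \<subseteq> {1..n - 1}" "T \<subseteq> {1..n - 1}"
  shows "co_mirror n T \<subseteq> co_mirror n S \<longleftrightarrow> S \<subseteq> T"
proof -
  have anti: "co_mirror n B \<subseteq> co_mirror n A" if "A \<subseteq> B" for A B
    using that by (auto simp: co_mirror_def)
  show ?thesis
    using anti[of S T] anti[of "co_mirror n T" "co_mirror n S"]
      co_mirror_co_mirror[OF assms(1)] co_mirror_co_mirror[OF assms(2)] by auto
qed

lemma weak_descents_subset: "weak_descents n v \<subseteq> {1..n - 1}"
  by (auto simp: weak_descents_def)

lemma strict_descents_subset: "strict_descents n v \<subseteq> {1..n - 1}"
  by (auto simp: strict_descents_def)

lemma weak_descents_reverse_on: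
  "weak_descents n (reverse_on n v) = co_mirror n (strict_descents n v)"
proof -
  have "reverse_on n v (Suc i) \<le> reverse_on n v i \<longleftrightarrow> n - i \<notin> strict_descents n v"
    if "i \<in> {1..n - 1}" for i
    using that by (auto simp: reverse_on_def strict_descents_def Suc_diff_le)
  then show ?thesis by (auto simp: weak_descents_def co_mirror_def)
qed

lemma weak_descents_complement_reverse_on:
  "weak_descents n (complement_on n (reverse_on n u)) = {i \<in> {1..n - 1}. n - i \<in> weak_descents n u}"
proof -
  let ?r = "reverse_on n u" and ?c = "complement_on n (reverse_on n u)"
  have "?c (Suc i) \<le> ?c i \<longleftrightarrow> n - i \<in> weak_descents n u" if i: "i \<in> {1..n - 1}" for i
  proof -
    have i_mem: "i \<in> {1..n}" "Suc i \<in> {1..n}" using i by auto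
    \<comment> \<open>Truncated subtraction from the maximum still reverses the order, as no value exceeds it.\<close>
    define M where "M = Max (?r ` {1..n})"
    have "?r i \<le> M" "?r (Suc i) \<le> M"
      unfolding M_def using i_mem by (meson Max_ge finite_atLeastAtMost finite_imageI image_eqI)+
    moreover have "?c i = M + 1 - ?r i" "?c (Suc i) = M + 1 - ?r (Suc i)"
      using i_mem by (simp_all add: complement_on_def M_def)
    ultimately have "?c (Suc i) \<le> ?c i \<longleftrightarrow> ?r i \<le> ?r (Suc i)"
      by auto
    also have "\<dots> \<longleftrightarrow> n - i \<in> weak_descents n u"
      using i by (auto simp: reverse_on_def weak_descents_def Suc_diff_le)
    finally show ?thesis .
  qed
  then show ?thesis by (auto simp: weak_descents_def[of n ?c])
qed

lemma weak_descents_rev_conjugate: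
  assumes "n \<ge> 1"
  shows "weak_descents n (conjugate n (complement_on n (reverse_on n u)))
    = co_mirror n (weak_descents n u)"
  unfolding conjugate(2)[OF assms] weak_descents_complement_reverse_on
  by (auto simp: co_mirror_def)

lemma rev_conjugate_involution:
  assumes "n \<ge> 1" "u \<in> inc_Cay n"
  defines "\<phi> \<equiv> \<lambda>u. conjugate n (complement_on n (reverse_on n u))"
  shows "\<phi> (\<phi> u) = u"
proof (rule inj_onD[OF inj_on_weak_descents])
  show "weak_descents n (\<phi> (\<phi> u)) = weak_descents n u"
    unfolding \<phi>_def weak_descents_rev_conjugate[OF assms(1)]
    by (rule co_mirror_co_mirror[OF weak_descents_subset])
  show "\<phi> (\<phi> u) \<in> inc_Cay n" unfolding \<phi>_def by (rule conjugate(1)[OF assms(1)])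
qed (use assms in auto)

lemma reverse_on_Cay:
  assumes "v \<in> Cay n"
  shows "reverse_on n v \<in> Cay n"
proof -
  have refl: "(\<lambda>i. n + 1 - i) ` {1..n} = {1..n}"
    by (rule bij_betw_imp_surj_on, rule bij_betw_byWitness[where f' = "\<lambda>i. n + 1 - i"]) auto
  have "reverse_on n v ` {1..n} = v ` (\<lambda>i. n + 1 - i) ` {1..n}"
    by (simp add: reverse_on_def image_image)
  then have img: "reverse_on n v ` {1..n} = v ` {1..n}" unfolding refl .
  moreover have "v ` {1..n} \<subseteq> {1..n}" using assms by (auto simp: Cay_def)
  then have "reverse_on n v \<in> {1..n} \<rightarrow>\<^sub>E {1..n}"
    using img by (fastforce simp: PiE_def reverse_on_def)
  ultimately show ?thesis using assms by (auto simp: Cay_def)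
qed

lemma reverse_on_involution:
  assumes "v \<in> extensional {1..n}"
  shows "reverse_on n (reverse_on n v) = v"
  by (rule extensionalityI[of _ "{1..n}"]) (use assms in \<open>auto simp: reverse_on_def\<close>)

section \<open>The bijection\<close>

lemma theta_in_product:
  assumes "n \<ge> 1" "x \<in> inc_Cay n \<times> Cay n"
  shows "theta n x \<in> inc_Cay n \<times> Cay n"
  using assms by (auto simp: theta_def conjugate(1) reverse_on_Cay)

lemma theta_involution:
  assumes "n \<ge> 1" "x \<in> inc_Cay n \<times> Cay n"
  shows "theta n (theta n x) = x"
  using assms
  by (auto simp: theta_def rev_conjugate_involution Cay_def PiE_def intro!: reverse_on_involution)

lemma theta_in_Omega_iff:
  assumes "n \<ge> 1" "x \<in> inc_Cay n \<times> Cay n"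
  shows "theta n x \<in> Omega n \<longleftrightarrow> x \<in> Bur01 n"
proof -
  obtain u v where x: "x = (u, v)" by fastforce
  have "theta n x \<in> Omega n \<longleftrightarrow>
      co_mirror n (strict_descents n v) \<subseteq> co_mirror n (weak_descents n u)"
    using theta_in_product[OF assms]
    by (simp add: x theta_def Omega_def weak_descents_reverse_on
        weak_descents_rev_conjugate[OF assms(1)])
  also have "\<dots> \<longleftrightarrow> x \<in> Bur01 n"
    using assms(2)
    by (simp add: x Bur01_def co_mirror_subset_iff[OF weak_descents_subset strict_descents_subset])
  finally show ?thesis .
qed

theorem proposition3p4:
  fixes n :: nat
  assumes "n \<ge> 1"
  shows "bij_betw (theta n) (Bur01 n) (Omega n)"
proof (rule bij_betw_byWitness[where f' = "theta n"])
  have Bur: "x \<in> inc_Cay n \<times> Cay n" if "x \<in> Bur01 n" for x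
    using that by (auto simp: Bur01_def)
  have Om: "y \<in> inc_Cay n \<times> Cay n" if "y \<in> Omega n" for y
    using that by (auto simp: Omega_def)
  show "\<forall>x\<in>Bur01 n. theta n (theta n x) = x"
    using theta_involution[OF assms Bur] by blast
  show "\<forall>y\<in>Omega n. theta n (theta n y) = y"
    using theta_involution[OF assms Om] by blast
  show "theta n ` Bur01 n \<subseteq> Omega n"
    using theta_in_Omega_iff[OF assms Bur] by blast
  show "theta n ` Omega n \<subseteq> Bur01 n"
  proof
    fix x assume "x \<in> theta n ` Omega n"
    then obtain y where y: "y \<in> Omega n" "x = theta n y" by blast
    then show "x \<in> Bur01 n"
      using theta_in_Omega_iff[OF assms theta_in_product[OF assms Om[OF y(1)]]]
        theta_involution[OF assms Om[OF y(1)]] by simp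
  qed
qed

end
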